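(* Let $(X,p,E)$ be a sequentially $p$-complete lattice-normed vector lattice such that $(E,\|\cdot\|_E)$ is a Banach lattice, and let $(Y,\|\cdot\|_Y)$ be a normed lattice. If $T:X\to Y$ is a positive linear operator, then $T$ is $p$-bounded as an operator from $(X,p,E)$ into $(Y,\|\cdot\|_Y,\mathbb{R})$.
   Context: All vector lattices are real and Archimedean. A net $(x_\alpha)$ in a vector lattice $X$ order converges to $x$ (written $x_\alpha\xrightarrow{o}x$) if there is a net $(y_\beta)_{\beta\in B}$ (possibly with a different index set) with $y_\beta\downarrow 0$ such that for every $\beta$ there is $\alpha_\beta$ with $|x_\alpha-x|\le y_\beta$ for all $\alpha\ge\alpha_\beta$. A lattice-normed space (LNS) is a triple $(X,p,E)$ with $X$ a real vector space, $E$ a vector lattice and $p:X\to E_+$ such that $p(x)=0\Leftrightarrow x=0$, $p(\lambda x)=|\lambda|p(x)$, $p(x+y)\le p(x)+p(y)$. If moreover $X$ is a vector lattice and $|x|\le|y|$ implies $p(x)\le p(y)$, it is a lattice-normed vector lattice (LNVL). A normed lattice $(Y,\|\cdot\|_Y)$ is regarded as the LNVL $(Y,\|\cdot\|_Y,\mathbb{R})$. A net $x_\alpha$ $p$-converges to $x$ if $p(x_\alpha-x)\xrightarrow{o}0$ in $E$. A sequence $x_n$ is $p$-Cauchy if the net $(x_n-x_{n'})_{(n,n')\in\mathbb{N}\times\mathbb{N}}$ $p$-converges to $0$; the LNS is sequentially $p$-complete if every $p$-Cauchy sequence is $p$-convergent. A subset $A\subseteq X$ is $p$-bounded if there is $e\in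 E$ with $p(a)\le e$ for all $a\in A$. A linear operator between LNSs is $p$-bounded if it maps $p$-bounded sets to $p$-bounded sets. *)

theory Defs
  imports "HOL-Analysis.Analysis" "HOL-Library.Lattice_Algebras" "HOL-Library.Product_Order"
begin

text \<open>Real Archimedean vector lattices. The modulus is \<open>\<bar>x\<bar> = sup x (- x)\<close>, which is an axiom of
  \<^class>\<open>lattice_ab_group_add_abs\<close>.\<close>

class vector_lattice = ordered_real_vector + lattice_ab_group_add_abs +
  assumes vector_lattice_archimedean: "(\<And>n::nat. real n *\<^sub>R x \<le> y) \<Longrightarrow> x \<le> 0"

class normed_lattice = vector_lattice + real_normed_vector +
  assumes norm_mono_abs: "\<bar>x\<bar> \<le> \<bar>y\<bar> \<Longrightarrow> norm x \<le> norm y"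

class banach_lattice = normed_lattice + banach

instance real :: banach_lattice
proof
  fix x y :: real
  show "x \<le> 0" if "\<And>n::nat. real n *\<^sub>R x \<le> y"
  proof (rule ccontr)
    assume "\<not> x \<le> 0"
    then obtain n :: nat where "y < real n * x"
      using reals_Archimedean3[of x] by auto
    with that[of n] show False by simp
  qed
qed simp

text \<open>A net is a family over a carrier \<open>A\<close> that is directed by a preorder \<open>le\<close>.\<close>

definition directed_by :: "'a set \<Rightarrow> ('a \<Rightarrow> 'a \<Rightarrow> bool) \<Rightarrow> bool" where
  "directed_by A le \<longleftrightarrow>
     A \<noteq> {} \<and>
     (\<forall>a\<in>A. le a a) \<and>
     (\<forall>a\<in>A. \<forall>b\<in>A. \<forall>c\<in>A. le a b \<longrightarrow> le b c \<longrightarrow> le a c) \<and>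
     (\<forall>a\<in>A. \<forall>b\<in>A. \<exists>c\<in>A. le a c \<and> le b c)"

definition decreases_to_0 ::
    "'b set \<Rightarrow> ('b \<Rightarrow> 'b \<Rightarrow> bool) \<Rightarrow> ('b \<Rightarrow> 'e::vector_lattice) \<Rightarrow> bool" where
  "decreases_to_0 B le y \<longleftrightarrow>
     directed_by B le \<and>
     (\<forall>b\<in>B. \<forall>c\<in>B. le b c \<longrightarrow> y c \<le> y b) \<and>
     (\<forall>b\<in>B. 0 \<le> y b) \<and>
     (\<forall>z. (\<forall>b\<in>B. z \<le> y b) \<longrightarrow> z \<le> 0)"

text \<open>HOL cannot quantify over the type of the index set of the dominating net \<open>y\<close> inside a
  definition. Index sets contained in the type \<open>'e\<close> suffice, since a decreasing net may be
  re-indexed by its range; see \<open>order_convergesI\<close> below.\<close>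

definition order_converges ::
    "'a set \<Rightarrow> ('a \<Rightarrow> 'a \<Rightarrow> bool) \<Rightarrow> ('a \<Rightarrow> 'e::vector_lattice) \<Rightarrow> 'e \<Rightarrow> bool" where
  "order_converges A le x l \<longleftrightarrow>
     directed_by A le \<and>
     (\<exists>(B :: 'e set) leB (y :: 'e \<Rightarrow> 'e). decreases_to_0 B leB y \<and>
        (\<forall>b\<in>B. \<exists>a0\<in>A. \<forall>a\<in>A. le a0 a \<longrightarrow> \<bar>x a - l\<bar> \<le> y b))"

lemma order_convergesI:
  fixes B :: "'b set" and y :: "'b \<Rightarrow> 'e::vector_lattice"
  assumes "directed_by A le" and y: "decreases_to_0 B leB y"
    and dom: "\<forall>b\<in>B. \<exists>a0\<in>A. \<forall>a\<in>A. le a0 a \<longrightarrow> \<bar>x a - l\<bar> \<le> y b"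
  shows "order_converges A le x l"
proof -
  have dir: "directed_by B leB" and anti: "\<And>b c. b \<in> B \<Longrightarrow> c \<in> B \<Longrightarrow> leB b c \<Longrightarrow> y c \<le> y b"
    using y by (auto simp: decreases_to_0_def)
  have "\<exists>c\<in>B. y c \<le> y a \<and> y c \<le> y b" if "a \<in> B" "b \<in> B" for a b
  proof -
    obtain c where "c \<in> B" "leB a c" "leB b c"
      using dir \<open>a \<in> B\<close> \<open>b \<in> B\<close> unfolding directed_by_def by blast
    then show ?thesis
      using anti that by blast
  qed
  moreover have "B \<noteq> {}"
    using dir by (simp add: directed_by_def)
  ultimately have "directed_by (y ` B) (\<ge>)"
    unfolding directed_by_def by simp (meson order_trans)
  then have "decreases_to_0 (y ` B) (\<ge>) (\<lambda>v. v)"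
    using y by (simp add: decreases_to_0_def)
  moreover have "\<forall>b\<in>y ` B. \<exists>a0\<in>A. \<forall>a\<in>A. le a0 a \<longrightarrow> \<bar>x a - l\<bar> \<le> b"
    using dom by blast
  ultimately show ?thesis
    unfolding order_converges_def using assms(1) by (intro conjI exI)
qed

locale lattice_normed_space =
  fixes p :: "'x::real_vector \<Rightarrow> 'e::vector_lattice"
  assumes p_nonneg: "0 \<le> p x"
    and p_eq_0_iff: "p x = 0 \<longleftrightarrow> x = 0"
    and p_scaleR: "p (c *\<^sub>R x) = \<bar>c\<bar> *\<^sub>R p x"
    and p_triangle: "p (x + y) \<le> p x + p y"

locale lattice_normed_vector_lattice = lattice_normed_space p
  for p :: "'x::vector_lattice \<Rightarrow> 'e::vector_lattice" +
  assumes p_mono: "\<bar>x\<bar> \<le> \<bar>y\<bar> \<Longrightarrow> p x \<le> p y"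

lemma lattice_normed_vector_lattice_norm:
  "lattice_normed_vector_lattice (norm :: 'y::normed_lattice \<Rightarrow> real)"
  by unfold_locales (auto simp: norm_triangle_ineq norm_mono_abs)

definition p_converges ::
    "('x::real_vector \<Rightarrow> 'e::vector_lattice) \<Rightarrow>
     'a set \<Rightarrow> ('a \<Rightarrow> 'a \<Rightarrow> bool) \<Rightarrow> ('a \<Rightarrow> 'x) \<Rightarrow> 'x \<Rightarrow> bool" where
  "p_converges p A le x l \<longleftrightarrow> order_converges A le (\<lambda>a. p (x a - l)) 0"

text \<open>On \<^typ>\<open>nat \<times> nat\<close> the relation \<open>(\<le>)\<close> is the componentwise order of
  \<^theory>\<open>HOL-Library.Product_Order\<close>.\<close>

definition p_Cauchy :: "('x::real_vector \<Rightarrow> 'e::vector_lattice) \<Rightarrow> (nat \<Rightarrow> 'x) \<Rightarrow> bool" where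
  "p_Cauchy p x \<longleftrightarrow>
     p_converges p (UNIV :: (nat \<times> nat) set) (\<le>) (\<lambda>(n, n'). x n - x n') 0"

definition sequentially_p_complete :: "('x::real_vector \<Rightarrow> 'e::vector_lattice) \<Rightarrow> bool" where
  "sequentially_p_complete p \<longleftrightarrow>
     (\<forall>x. p_Cauchy p x \<longrightarrow> (\<exists>l. p_converges p (UNIV :: nat set) (\<le>) x l))"

definition p_bounded :: "('x::real_vector \<Rightarrow> 'e::vector_lattice) \<Rightarrow> 'x set \<Rightarrow> bool" where
  "p_bounded p A \<longleftrightarrow> (\<exists>e. \<forall>a\<in>A. p a \<le> e)"

definition p_bounded_operator ::
    "('x::real_vector \<Rightarrow> 'e::vector_lattice) \<Rightarrow> ('y::real_vector \<Rightarrow> 'f::vector_lattice) \<Rightarrow>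
     ('x \<Rightarrow> 'y) \<Rightarrow> bool" where
  "p_bounded_operator p q T \<longleftrightarrow> linear T \<and> (\<forall>A. p_bounded p A \<longrightarrow> p_bounded q (T ` A))"

definition positive_operator :: "('x::vector_lattice \<Rightarrow> 'y::vector_lattice) \<Rightarrow> bool" where
  "positive_operator T \<longleftrightarrow> linear T \<and> (\<forall>x. 0 \<le> x \<longrightarrow> 0 \<le> T x)"

end

(* If norm (T a) is unbounded on a set A with p a \<le> e, choose a k in A with norm (T (a k)) > k * 2 ^ k.
   The partial sums of (1/2) ^ k * \<bar>a k\<bar> are p-Cauchy, and their p-limit s dominates every term because
   the positive cone is p-closed; hence norm (T (a k)) \<le> 2 ^ k * norm (T s) for all k, a contradiction.
   The Archimedean property gives (1/2) ^ k * e \<down> 0, which controls the tails. *)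
theory Submission
  imports Defs
begin

text \<open>A lower bound \<open>z\<close> satisfies \<open>2 ^ n *\<^sub>R sup z 0 \<le> e\<close>
  for every \<open>n\<close>; since \<open>2 ^ n\<close> exceeds \<open>n\<close>, the Archimedean
  property forces \<open>sup z 0 \<le> 0\<close>.\<close>

lemma decreases_to_0_geometric:
  fixes e :: "'e::vector_lattice"
  assumes "0 \<le> e"
  shows "decreases_to_0 (UNIV :: nat set) (\<le>) (\<lambda>k. (1/2) ^ k *\<^sub>R e)"
proof -
  have inf0: "z \<le> 0" if z: "\<And>k::nat. z \<le> (1/2) ^ k *\<^sub>R e" for z
  proof -
    \<comment> \<open>The positive part replaces \<open>z\<close> because enlarging the factor from
      \<open>n\<close> to \<open>2 ^ n\<close> preserves the inequality only for a nonnegative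
      vector.\<close>
    have "real n *\<^sub>R sup z 0 \<le> e" for n
    proof -
      have "sup z 0 \<le> (1/2) ^ n *\<^sub>R e"
        using z[of n] assms by (simp add: scaleR_nonneg_nonneg)
      then have "(2 ^ n) *\<^sub>R sup z 0 \<le> (2 ^ n) *\<^sub>R ((1/2) ^ n *\<^sub>R e)"
        by (intro scaleR_left_mono) auto
      also have "\<dots> = e"
        by (simp flip: power_mult_distrib)
      finally have "(2 ^ n) *\<^sub>R sup z 0 \<le> e" .
      moreover have "real n *\<^sub>R sup z 0 \<le> (2 ^ n) *\<^sub>R sup z 0"
        by (intro scaleR_right_mono) (auto intro: less_imp_le)
      ultimately show ?thesis
        by (rule order_trans[rotated])
    qed
    then have "sup z 0 \<le> 0"
      by (rule vector_lattice_archimedean)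
    then show ?thesis by simp
  qed
  have "directed_by (UNIV :: nat set) (\<le>)"
    unfolding directed_by_def by (auto intro: max.cobounded1 max.cobounded2)
  then show ?thesis
    unfolding decreases_to_0_def
    using assms inf0 by (auto intro!: scaleR_right_mono power_decreasing scaleR_nonneg_nonneg)
qed

context lattice_normed_space
begin

lemma p_zero [simp]: "p 0 = 0"
  by (simp add: p_eq_0_iff)

lemma p_minus_commute: "p (x - y) = p (y - x)"
  using p_scaleR[of "-1" "y - x"] by simp

text \<open>By the triangle inequality each new term adds at most
  \<open>(1/2) ^ k *\<^sub>R e\<close>, and the right-hand side is the exact geometric sum of these
  for \<open>m \<le> k < n\<close>. The cruder bound \<open>2 * (1/2) ^ m\<close> would not survive
  the induction on \<open>n\<close>.\<close>

lemma p_partial_sums_diff_le: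
  assumes "\<And>k. p (u k) \<le> e" and "m \<le> n"
  shows "p ((\<Sum>k<n. (1/2) ^ k *\<^sub>R u k) - (\<Sum>k<m. (1/2) ^ k *\<^sub>R u k))
           \<le> (2 * (1/2) ^ m - 2 * (1/2) ^ n) *\<^sub>R e"
  using \<open>m \<le> n\<close>
proof (induction n rule: dec_induct)
  case base
  then show ?case by simp
next
  case (step n)
  let ?s = "\<lambda>n. \<Sum>k<n. (1/2) ^ k *\<^sub>R u k"
  have "p (?s (Suc n) - ?s m) = p ((?s n - ?s m) + (1/2) ^ n *\<^sub>R u n)"
    by (simp add: algebra_simps)
  also have "\<dots> \<le> p (?s n - ?s m) + p ((1/2) ^ n *\<^sub>R u n)"
    by (rule p_triangle)
  also have "\<dots> \<le> (2 * (1/2) ^ m - 2 * (1/2) ^ n) *\<^sub>R e + (1/2) ^ n *\<^sub>R e"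
    using step.IH assms(1)[of n]
    by (intro add_mono) (auto simp: p_scaleR intro: scaleR_left_mono)
  also have "\<dots> = (2 * (1/2) ^ m - 2 * (1/2) ^ Suc n) *\<^sub>R e"
    by (simp flip: scaleR_add_left)
  finally show ?case .
qed

text \<open>All differences of partial sums beyond index \<open>N\<close> are bounded by the
  geometric tail \<open>(1/2) ^ N *\<^sub>R 2 *\<^sub>R e\<close>, which decreases to 0 in
  \<open>N\<close>.\<close>

lemma p_Cauchy_partial_sums:
  assumes u: "\<And>k. p (u k) \<le> e"
  shows "p_Cauchy p (\<lambda>n. \<Sum>k<n. (1/2) ^ k *\<^sub>R u k)"
proof -
  let ?s = "\<lambda>n. \<Sum>k<n. (1/2) ^ k *\<^sub>R u k"
  have e: "0 \<le> e"
    using p_nonneg u by (rule order_trans)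
  have ordered: "p (?s n - ?s m) \<le> (1/2) ^ N *\<^sub>R 2 *\<^sub>R e" if "N \<le> m" "m \<le> n" for N m n
  proof -
    have "p (?s n - ?s m) \<le> (2 * (1/2) ^ m - 2 * (1/2) ^ n) *\<^sub>R e"
      using u that(2) by (rule p_partial_sums_diff_le)
    also have "\<dots> \<le> ((1/2) ^ N * 2) *\<^sub>R e"
    proof (rule scaleR_right_mono[OF _ e])
      have "(1/2::real) ^ m \<le> (1/2) ^ N"
        using that(1) by (intro power_decreasing) auto
      moreover have "0 \<le> (1/2::real) ^ n" by simp
      ultimately show "2 * (1/2) ^ m - 2 * (1/2) ^ n \<le> (1/2::real) ^ N * 2" by linarith
    qed
    finally show ?thesis by simp
  qed
  \<comment> \<open>The Cauchy net runs over all pairs of indices, so the estimate is freed of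
    \<open>m \<le> n\<close> by the symmetry of \<open>p (x - y)\<close>.\<close>
  have tail: "p (?s n - ?s m) \<le> (1/2) ^ N *\<^sub>R 2 *\<^sub>R e" if "N \<le> m" "N \<le> n" for N m n
    using ordered[of N m n] ordered[of N n m] that p_minus_commute[of "?s n" "?s m"]
    by (cases "m \<le> n") auto
  have "directed_by (UNIV :: (nat \<times> nat) set) (\<le>)"
    unfolding directed_by_def
    by (auto simp: less_eq_prod_def intro: max.cobounded1 max.cobounded2)
  moreover have "decreases_to_0 (UNIV :: nat set) (\<le>) (\<lambda>k. (1/2) ^ k *\<^sub>R 2 *\<^sub>R e)"
    using e by (intro decreases_to_0_geometric scaleR_nonneg_nonneg) auto
  moreover have "\<forall>N\<in>UNIV. \<exists>a0\<in>UNIV. \<forall>a\<in>UNIV. a0 \<le> a \<longrightarrow>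
      \<bar>p ((case a of (n, n') \<Rightarrow> ?s n - ?s n') - 0) - 0\<bar> \<le> (1/2) ^ N *\<^sub>R 2 *\<^sub>R e"
  proof
    fix N :: nat
    show "\<exists>a0\<in>UNIV. \<forall>a\<in>UNIV. a0 \<le> a \<longrightarrow>
      \<bar>p ((case a of (n, n') \<Rightarrow> ?s n - ?s n') - 0) - 0\<bar> \<le> (1/2) ^ N *\<^sub>R 2 *\<^sub>R e"
      by (rule bexI[of _ "(N, N)"])
        (auto simp: less_eq_prod_def abs_of_nonneg p_nonneg intro!: tail[simplified])
  qed
  ultimately show ?thesis
    unfolding p_Cauchy_def p_converges_def by (rule order_convergesI)
qed

end

context lattice_normed_vector_lattice
begin

lemma p_abs: "p \<bar>x\<bar> = p x"
  by (intro antisym p_mono) simp_all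

text \<open>For \<open>n \<ge> N\<close> the positive part of \<open>s N - l\<close> lies below
  \<open>\<bar>s n - l\<bar>\<close>. Its \<open>p\<close>-value is therefore below every member of
  the dominating net, hence 0.\<close>

lemma incseq_le_p_limit:
  fixes s :: "nat \<Rightarrow> 'x"
  assumes "incseq s" and "p_converges p UNIV (\<le>) s l"
  shows "s N \<le> l"
proof -
  obtain B :: "'e set" and leB y where y: "decreases_to_0 B leB y"
    and dom: "\<And>b. b \<in> B \<Longrightarrow> \<exists>n0. \<forall>n\<ge>n0. \<bar>p (s n - l) - 0\<bar> \<le> y b"
    using assms(2) unfolding p_converges_def order_converges_def by auto
  have "p (sup (s N - l) 0) \<le> y b" if b: "b \<in> B" for b
  proof -
    obtain n0 where n0: "\<And>n. n0 \<le> n \<Longrightarrow> p (s n - l) \<le> y b"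
      using dom[OF b] by (auto simp: abs_of_nonneg p_nonneg)
    \<comment> \<open>Being past \<open>n0\<close> gives the bound by \<open>y b\<close>; being past
      \<open>N\<close> gives \<open>s N \<le> s ?n\<close>.\<close>
    let ?n = "max n0 N"
    have "s N - l \<le> s ?n - l"
      using incseqD[OF assms(1), of N ?n] by simp
    also have "\<dots> \<le> \<bar>s ?n - l\<bar>"
      by (rule abs_ge_self)
    finally have "sup (s N - l) 0 \<le> \<bar>s ?n - l\<bar>"
      by simp
    then have "p (sup (s N - l) 0) \<le> p (s ?n - l)"
      by (intro p_mono) (simp add: abs_of_nonneg)
    also have "\<dots> \<le> y b"
      by (rule n0) simp
    finally show ?thesis .
  qed
  then have "p (sup (s N - l) 0) \<le> 0"
    using y by (auto simp: decreases_to_0_def)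
  then have "sup (s N - l) 0 = 0"
    using p_nonneg p_eq_0_iff by (metis antisym)
  then have "s N - l \<le> 0"
    by (metis sup.cobounded1)
  then show ?thesis by simp
qed

end

lemma positive_operator_mono:
  assumes "positive_operator T" and "x \<le> y"
  shows "T x \<le> T y"
proof -
  have "0 \<le> T (y - x)"
    using assms by (simp add: positive_operator_def)
  then show ?thesis
    using assms(1) by (simp add: positive_operator_def linear_diff)
qed

text \<open>Since both \<open>x\<close> and \<open>- x\<close> lie below \<open>y\<close>,
  positivity gives \<open>\<bar>T x\<bar> \<le> T y\<close>, and the lattice norm is monotone in the
  modulus.\<close>

lemma norm_positive_operator_mono:
  fixes T :: "'x::vector_lattice \<Rightarrow> 'y::normed_lattice"
  assumes "positive_operator T" and "\<bar>x\<bar> \<le> y"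
  shows "norm (T x) \<le> norm (T y)"
proof (rule norm_mono_abs)
  have "x \<le> y" "- x \<le> y"
    using assms(2) by (auto intro: order_trans[OF abs_ge_self] order_trans[OF abs_ge_minus_self])
  then have "T x \<le> T y" "T (- x) \<le> T y"
    using assms(1) positive_operator_mono by blast+
  then have "\<bar>T x\<bar> \<le> T y"
    using assms(1) by (intro abs_leI) (auto simp: positive_operator_def linear_neg)
  then show "\<bar>T x\<bar> \<le> \<bar>T y\<bar>"
    using abs_ge_self by (rule order_trans)
qed

theorem theorem2:
  fixes p :: "'x::vector_lattice \<Rightarrow> 'e::banach_lattice"
    and T :: "'x \<Rightarrow> 'y::normed_lattice"
  assumes "lattice_normed_vector_lattice p"
    and "sequentially_p_complete p"
    and "positive_operator T"
  shows "p_bounded_operator p (norm :: 'y \<Rightarrow> real) T"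
proof -
  interpret lattice_normed_vector_lattice p by fact
  have lin: "linear T"
    using assms(3) by (simp add: positive_operator_def)
  have "p_bounded (norm :: 'y \<Rightarrow> real) (T ` A)" if "p_bounded p A" for A
  proof (rule ccontr)
    assume unbdd: "\<not> p_bounded (norm :: 'y \<Rightarrow> real) (T ` A)"
    obtain e where e: "\<And>a. a \<in> A \<Longrightarrow> p a \<le> e"
      using \<open>p_bounded p A\<close> unfolding p_bounded_def by blast
    \<comment> \<open>The factor \<open>2 ^ k\<close> offsets the weight \<open>(1/2) ^ k\<close>
      that the chosen element receives in the series; the factor \<open>k\<close> remains and is
      unbounded.\<close>
    have "\<exists>a\<in>A. real k * 2 ^ k < norm (T a)" for k :: nat
      using unbdd unfolding p_bounded_def by (auto simp: not_le)
    then obtain a where aA: "\<And>k. a k \<in> A" and a: "\<And>k::nat. real k * 2 ^ k < norm (T (a k))"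
      by metis
    define s where "s n = (\<Sum>k<n. (1/2) ^ k *\<^sub>R \<bar>a k\<bar>)" for n
    have "p_Cauchy p s"
      unfolding s_def by (rule p_Cauchy_partial_sums[where e = e]) (simp add: p_abs e aA)
    then obtain l where l: "p_converges p UNIV (\<le>) s l"
      using assms(2) unfolding sequentially_p_complete_def by blast
    have s_pos: "0 \<le> s n" for n
      unfolding s_def by (intro sum_nonneg scaleR_nonneg_nonneg) auto
    have "incseq s"
      by (rule incseq_SucI) (simp add: s_def scaleR_nonneg_nonneg)
    have "real k \<le> norm (T l)" for k
    proof -
      have "(1/2) ^ k *\<^sub>R \<bar>a k\<bar> \<le> s (Suc k)"
        using s_pos[of k] by (simp add: s_def)
      also have "\<dots> \<le> l"
        using \<open>incseq s\<close> l by (rule incseq_le_p_limit)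
      finally have "2 ^ k *\<^sub>R (1/2) ^ k *\<^sub>R \<bar>a k\<bar> \<le> 2 ^ k *\<^sub>R l"
        by (intro scaleR_left_mono) auto
      then have "\<bar>a k\<bar> \<le> 2 ^ k *\<^sub>R l"
        by (simp flip: power_mult_distrib)
      with assms(3) have "norm (T (a k)) \<le> norm (T (2 ^ k *\<^sub>R l))"
        by (rule norm_positive_operator_mono)
      also have "\<dots> = norm (T l) * 2 ^ k"
        by (simp add: linear_scale[OF lin])
      finally have "real k * 2 ^ k \<le> norm (T l) * 2 ^ k"
        using a[of k] by linarith
      then show ?thesis by simp
    qed
    then show False
      by (meson linorder_not_le reals_Archimedean2)
  qed
  with lin show ?thesis
    by (simp add: p_bounded_operator_def)
qed

end
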